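(* Let $f(z)=zh(z)\overline{g(z)}\in T_{Lh}$ be a univalent sense-preserving logharmonic mapping in $U$. If its second dilatation function $a$ has real coefficients, that is, $a(\overline{z})=\overline{a(z)}$ for all $z\in U$, then $f(U)$ is symmetric with respect to the real axis.
   Context: $U=\{z\in\mathbb{C}:|z|<1\}$; $\mathcal{H}(U)$ is the space of analytic functions on $U$; $B$ is the set of $a\in\mathcal{H}(U)$ with $|a|<1$ in $U$. A function $f$ on $U$ is a logharmonic mapping with respect to $a\in B$ if $\overline{\left(f_{\overline z}/f\right)}=a\,f_z/f$ in $U$ (where $f\neq 0$); $a$ is called the second dilatation function of $f$. Univalent means injective. An analytic function $\varphi$ in $U$ is typically real if $\varphi(z)$ is real whenever $z\in U$ is real and $\varphi(z)$ is nonreal for all other $z\in U$. $T_{Lh}$ is the class of logharmonic mappings $f(z)=zh(z)\overline{g(z)}$ in $U$ (with respect to some $a\in B$), where $h,g\in\mathcal{H}(U)$, $h(0)=1=g(0)$, $0\notin(hg)(U)$, such that $\varphi(z)=zh(z)g(z)$ is typically real in $U$. *)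

theory Defs
  imports "HOL-Complex_Analysis.Complex_Analysis"
begin

abbreviation unit_disc :: "complex set" where
  "unit_disc \<equiv> ball 0 1"

definition dilatations :: "(complex \<Rightarrow> complex) set" where
  "dilatations = {a. a holomorphic_on unit_disc \<and> (\<forall>z\<in>unit_disc. cmod (a z) < 1)}"

text \<open>
  The Wirtinger derivatives \<open>f\<^sub>z = (f\<^sub>x - i f\<^sub>y) / 2\<close> and \<open>f\<^sub>z\<^sub>* = (f\<^sub>x + i f\<^sub>y) / 2\<close>
  (with \<open>z\<^sub>*\<close> the conjugate of \<open>z\<close>). On \<^typ>\<open>complex\<close>, \<^const>\<open>frechet_derivative\<close> is the
  real-linear total derivative, so its values at \<open>1\<close> and \<open>\<i>\<close> are \<open>f\<^sub>x\<close> and \<open>f\<^sub>y\<close>; they are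
  meaningful only where \<open>f\<close> is real-differentiable.
\<close>

definition wirtinger_z :: "(complex \<Rightarrow> complex) \<Rightarrow> complex \<Rightarrow> complex" where
  "wirtinger_z f z =
     (frechet_derivative f (at z) 1 - \<i> * frechet_derivative f (at z) \<i>) / 2"

definition wirtinger_zbar :: "(complex \<Rightarrow> complex) \<Rightarrow> complex \<Rightarrow> complex" where
  "wirtinger_zbar f z =
     (frechet_derivative f (at z) 1 + \<i> * frechet_derivative f (at z) \<i>) / 2"

definition logharmonic_wrt :: "(complex \<Rightarrow> complex) \<Rightarrow> (complex \<Rightarrow> complex) \<Rightarrow> bool" where
  "logharmonic_wrt a f \<longleftrightarrow>
     a \<in> dilatations \<and>
     (\<forall>z\<in>unit_disc. f differentiable (at z)) \<and>
     (\<forall>z\<in>unit_disc. f z \<noteq> 0 \<longrightarrow>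
        cnj (wirtinger_zbar f z / f z) = a z * (wirtinger_z f z / f z))"

definition univalent :: "(complex \<Rightarrow> complex) \<Rightarrow> bool" where
  "univalent f \<longleftrightarrow> inj_on f unit_disc"

text \<open>Positivity of the Jacobian, which equals \<open>|f\<^sub>z|\<^sup>2\<close> minus the squared modulus of
  the conjugate derivative.\<close>

definition sense_preserving :: "(complex \<Rightarrow> complex) \<Rightarrow> bool" where
  "sense_preserving f \<longleftrightarrow>
     (\<forall>z\<in>unit_disc. (cmod (wirtinger_z f z))\<^sup>2 - (cmod (wirtinger_zbar f z))\<^sup>2 > 0)"

definition typically_real :: "(complex \<Rightarrow> complex) \<Rightarrow> bool" where
  "typically_real \<phi> \<longleftrightarrow>
     \<phi> holomorphic_on unit_disc \<and> (\<forall>z\<in>unit_disc. \<phi> z \<in> \<real> \<longleftrightarrow> z \<in> \<real>)"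

definition T_Lh :: "(complex \<Rightarrow> complex) set" where
  "T_Lh = {f. (\<exists>a. logharmonic_wrt a f) \<and>
     (\<exists>h g. h holomorphic_on unit_disc \<and> g holomorphic_on unit_disc \<and>
        h 0 = 1 \<and> g 0 = 1 \<and>
        0 \<notin> (\<lambda>z. h z * g z) ` unit_disc \<and>
        (\<forall>z\<in>unit_disc. f z = z * h z * cnj (g z)) \<and>
        typically_real (\<lambda>z. z * h z * g z))}"

end

theory Submission
  imports Defs
begin

text \<open>
  A logharmonic map \<open>f = p \<cdot> cnj g\<close> with \<open>p = z h\<close> satisfies \<open>p g' = a p' g\<close>, where \<open>a\<close> is its
  dilatation. Together with \<open>p g = \<phi>\<close>, this gives \<open>\<phi>' = (1 + a) p' g\<close>, that is,
  \<open>g'/g = a / (1 + a) \<cdot> \<phi>'/\<phi>\<close>. Hence the pair \<open>(\<phi>, a)\<close> determines \<open>g\<close> up to a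
  constant, which the normalisation \<open>g 0 = 1\<close> fixes
  (\<open>conjugate_factor_unique\<close>). A typically real \<open>\<phi>\<close> commutes with conjugation by the
  reflection principle (\<open>real_on_reals_imp_reflection_invariant\<close>), and so does \<open>a\<close>
  when its coefficients are real. The reflected pair \<open>cnj \<circ> p \<circ> cnj\<close>, \<open>cnj \<circ> g \<circ> cnj\<close> therefore
  solves the same problem as \<open>(p, g)\<close> and coincides with it, so
  \<open>f (cnj z) = cnj (f z)\<close>. The disc being symmetric, so is its image.
\<close>

lemma DERIV_reflection:
  assumes "f holomorphic_on unit_disc" "z \<in> unit_disc"
  shows "((\<lambda>w. cnj (f (cnj w))) has_field_derivative cnj (deriv f (cnj z))) (at z)"
proof -
  have "(f has_field_derivative deriv f (cnj z)) (at (cnj z))"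
    using assms by (intro holomorphic_derivI[of _ unit_disc]) auto
  from has_field_derivative_cnj_cnj[OF this] show ?thesis
    by (simp add: o_def)
qed

lemma holomorphic_reflection:
  assumes "f holomorphic_on unit_disc"
  shows "(\<lambda>w. cnj (f (cnj w))) holomorphic_on unit_disc"
  unfolding holomorphic_on_open[OF open_ball] using DERIV_reflection[OF assms] by blast

text \<open>
  The function and its reflection are both holomorphic and agree on the real diameter, which
  accumulates at \<open>0\<close>; the identity theorem spreads the equality to the whole disc.
\<close>

lemma real_on_reals_imp_reflection_invariant:
  assumes hol: "\<phi> holomorphic_on unit_disc"
    and real: "\<And>z. z \<in> unit_disc \<Longrightarrow> z \<in> \<real> \<Longrightarrow> \<phi> z \<in> \<real>"
    and z: "z \<in> unit_disc"
  shows "cnj (\<phi> (cnj z)) = \<phi> z"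
proof -
  let ?d = "\<lambda>z. cnj (\<phi> (cnj z)) - \<phi> z"
  have "?d z = 0"
  proof (rule analytic_continuation[of ?d unit_disc "unit_disc \<inter> \<real>" 0])
    show "?d holomorphic_on unit_disc"
      by (intro holomorphic_intros holomorphic_reflection hol)
    show "(0::complex) islimpt unit_disc \<inter> \<real>"
      unfolding islimpt_approachable
    proof (intro allI impI)
      fix e :: real assume "e > 0"
      define x :: complex where "x = of_real (min e 1 / 2)"
      have "x \<in> unit_disc \<inter> \<real>" "x \<noteq> 0" "dist x 0 < e"
        using \<open>e > 0\<close> by (auto simp: x_def min_def)
      then show "\<exists>x'\<in>unit_disc \<inter> \<real>. x' \<noteq> 0 \<and> dist x' 0 < e" by blast
    qed
    show "?d w = 0" if "w \<in> unit_disc \<inter> \<real>" for w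
      using that real[of w] by (simp add: Reals_cnj_iff)
  qed (use z in auto)
  then show ?thesis by simp
qed

lemma wirtinger_holomorphic_times_cnj:
  assumes S: "open S" "z \<in> S"
    and hol: "p holomorphic_on S" "g holomorphic_on S"
    and f: "\<And>w. w \<in> S \<Longrightarrow> f w = p w * cnj (g w)"
  shows "wirtinger_z f z = deriv p z * cnj (g z)"
    and "wirtinger_zbar f z = p z * cnj (deriv g z)"
proof -
  have p: "(p has_derivative (\<lambda>v. deriv p z * v)) (at z)"
    and g: "(g has_derivative (\<lambda>v. deriv g z * v)) (at z)"
    using holomorphic_derivI[OF hol(1) S] holomorphic_derivI[OF hol(2) S]
    by (simp_all add: has_field_derivative_def)
  have "((\<lambda>w. p w * cnj (g w)) has_derivative
      (\<lambda>v. p z * cnj (deriv g z * v) + deriv p z * v * cnj (g z))) (at z)"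
    by (intro has_derivative_mult p has_derivative_cnj g)
  then have "(f has_derivative
      (\<lambda>v. p z * cnj (deriv g z * v) + deriv p z * v * cnj (g z))) (at z)"
    by (rule has_derivative_transform_within_open[OF _ S]) (simp add: f)
  from frechet_derivative_at[OF this]
  have fd: "frechet_derivative f (at z) =
      (\<lambda>v. p z * cnj (deriv g z * v) + deriv p z * v * cnj (g z))" by simp
  show "wirtinger_z f z = deriv p z * cnj (g z)"
    and "wirtinger_zbar f z = p z * cnj (deriv g z)"
    by (simp_all add: wirtinger_z_def wirtinger_zbar_def fd algebra_simps)
qed

text \<open>
  The logharmonic equation of \<open>p \<cdot> cnj g\<close> cleared of denominators: conjugation turns the
  antiholomorphic factor into \<open>g\<close>, and what remains is holomorphic.
\<close>

lemma logharmonic_factor_equation: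
  assumes log: "logharmonic_wrt a f"
    and hol: "p holomorphic_on unit_disc" "g holomorphic_on unit_disc"
    and f: "\<And>w. w \<in> unit_disc \<Longrightarrow> f w = p w * cnj (g w)"
    and z: "z \<in> unit_disc" "p z \<noteq> 0" "g z \<noteq> 0"
  shows "p z * deriv g z = a z * (deriv p z * g z)"
proof -
  have "f z \<noteq> 0" using z f by simp
  then have "cnj (wirtinger_zbar f z / f z) = a z * (wirtinger_z f z / f z)"
    using log z by (auto simp: logharmonic_wrt_def)
  then have "cnj (p z * cnj (deriv g z) / (p z * cnj (g z))) =
      a z * (deriv p z * cnj (g z) / (p z * cnj (g z)))"
    using wirtinger_holomorphic_times_cnj[OF open_ball z(1) hol f] f z by simp
  then show ?thesis using z by (simp add: field_simps)
qed

text \<open>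
  Adding the two terms of \<open>(p g)' = p' g + p g'\<close> gives \<open>(p g)' = (1 + a) p' g\<close>, and the same holds
  for \<open>P, G\<close>. Since \<open>1 + a\<close> does not vanish, \<open>p' g = P' G\<close>, then \<open>p g' = P G'\<close>, so \<open>g\<close> and \<open>G\<close>
  have the same logarithmic derivative and \<open>G / g\<close> is constant. A finite set \<open>K\<close> is excluded
  from the equations to allow for the zero of \<open>p\<close> at the origin, where the logarithmic
  derivative of \<open>p g\<close> has a pole.
\<close>

lemma conjugate_factor_unique:
  fixes a p g P G :: "complex \<Rightarrow> complex"
  assumes S: "open S" "connected S" "finite K"
    and hol: "p holomorphic_on S" "g holomorphic_on S" "P holomorphic_on S" "G holomorphic_on S"
    and prod: "\<And>z. z \<in> S \<Longrightarrow> P z * G z = p z * g z"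
    and g0: "\<And>z. z \<in> S \<Longrightarrow> g z \<noteq> 0"
    and p0: "\<And>z. z \<in> S - K \<Longrightarrow> p z \<noteq> 0"
    and a: "\<And>z. z \<in> S - K \<Longrightarrow> a z \<noteq> -1"
    and eq: "\<And>z. z \<in> S - K \<Longrightarrow> p z * deriv g z = a z * (deriv p z * g z)"
    and eq': "\<And>z. z \<in> S - K \<Longrightarrow> P z * deriv G z = a z * (deriv P z * G z)"
    and norm: "w \<in> S" "G w = g w"
    and z: "z \<in> S"
  shows "G z = g z"
proof -
  have d: "((\<lambda>z. G z / g z) has_field_derivative 0) (at z)" if z: "z \<in> S - K" for z
  proof -
    have D: "(p has_field_derivative deriv p z) (at z)"
      "(g has_field_derivative deriv g z) (at z)"
      "(P has_field_derivative deriv P z) (at z)"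
      "(G has_field_derivative deriv G z) (at z)"
      using hol z S(1) by (auto intro: holomorphic_derivI)
    have "((\<lambda>z. p z * g z) has_field_derivative
        deriv P z * G z + deriv G z * P z) (at z)"
      by (rule has_field_derivative_transform_within_open[OF DERIV_mult[OF D(3,4)] S(1)])
        (use z prod in auto)
    from DERIV_unique[OF this DERIV_mult[OF D(1,2)]]
    have sum: "deriv P z * G z + P z * deriv G z = deriv p z * g z + p z * deriv g z"
      by (simp add: mult.commute)
    then have "(1 + a z) * (deriv P z * G z) = (1 + a z) * (deriv p z * g z)"
      using eq[OF z] eq'[OF z] by (simp add: algebra_simps)
    moreover have "1 + a z \<noteq> 0"
      using a[OF z] by (simp add: add_eq_0_iff)
    ultimately have "P z * deriv G z = p z * deriv g z"
      using sum by simp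
    then have "P z * G z * (deriv G z * g z) = p z * g z * (deriv g z * G z)"
      by (simp add: algebra_simps)
    moreover have "P z * G z = p z * g z" "p z * g z \<noteq> 0"
      using prod p0 g0 z by auto
    ultimately have "deriv G z * g z - G z * deriv g z = 0"
      by simp
    then show ?thesis
      using DERIV_divide[OF D(4,2)] g0 z by auto
  qed
  have "continuous_on S (\<lambda>z. G z / g z)"
    using hol g0 by (intro continuous_intros holomorphic_on_imp_continuous_on) auto
  then have "\<exists>c. \<forall>z\<in>S. G z / g z = c"
    using DERIV_zero_connected_constant[OF S(2,1,3)] d by (metis (lifting))
  then have "G z / g z = G w / g w" using norm(1) z by metis
  then show ?thesis using norm g0[OF z] g0[OF norm(1)] by simp
qed

theorem theorem4:
  fixes f a :: "complex \<Rightarrow> complex"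
  assumes "f \<in> T_Lh"
    and "univalent f"
    and "sense_preserving f"
    and "logharmonic_wrt a f"
    and "\<forall>z\<in>unit_disc. a (cnj z) = cnj (a z)"
  shows "cnj ` (f ` unit_disc) = f ` unit_disc"
proof -
  obtain h g where h: "h holomorphic_on unit_disc" and g: "g holomorphic_on unit_disc"
    and g1: "g 0 = 1"
    and nz: "0 \<notin> (\<lambda>z. h z * g z) ` unit_disc"
    and f: "\<forall>z\<in>unit_disc. f z = z * h z * cnj (g z)"
    and tr: "typically_real (\<lambda>z. z * h z * g z)"
    using assms(1) unfolding T_Lh_def by blast
  have hg0: "h z \<noteq> 0" "g z \<noteq> 0" if "z \<in> unit_disc" for z
    using nz that by force+
  define p where "p z = z * h z" for z
  have p: "p holomorphic_on unit_disc"
    unfolding p_def by (intro holomorphic_intros h)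
  have p0: "p z \<noteq> 0" if "z \<in> unit_disc - {0}" for z
    using hg0 that by (simp add: p_def)
  let ?P = "\<lambda>z. cnj (p (cnj z))" and ?G = "\<lambda>z. cnj (g (cnj z))"
  have prod: "?P z * ?G z = p z * g z" if "z \<in> unit_disc" for z
    using real_on_reals_imp_reflection_invariant[of "\<lambda>z. z * h z * g z" z] tr that
    by (simp add: typically_real_def p_def)
  have eq: "p z * deriv g z = a z * (deriv p z * g z)" if "z \<in> unit_disc - {0}" for z
    by (rule logharmonic_factor_equation[OF assms(4) p g])
      (use f p0 hg0 that in \<open>auto simp: p_def\<close>)
  have eq': "?P z * deriv ?G z = a z * (deriv ?P z * ?G z)"
    if z: "z \<in> unit_disc - {0}" for z
  proof -
    have "deriv ?P z = cnj (deriv p (cnj z))" "deriv ?G z = cnj (deriv g (cnj z))"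
      using z by (auto intro!: DERIV_imp_deriv DERIV_reflection p g)
    moreover have "a z = cnj (a (cnj z))" using assms(5) z by simp
    moreover have "cnj (p (cnj z) * deriv g (cnj z)) =
        cnj (a (cnj z) * (deriv p (cnj z) * g (cnj z)))"
      using eq[of "cnj z"] z by simp
    ultimately show ?thesis by simp
  qed
  have a: "a z \<noteq> -1" if "z \<in> unit_disc" for z
    using assms(4) that by (force simp: logharmonic_wrt_def dilatations_def)
  have G: "?G z = g z" if "z \<in> unit_disc" for z
    by (rule conjugate_factor_unique[of unit_disc "{0}" p g ?P ?G a 0])
      (use p g holomorphic_reflection[OF p] holomorphic_reflection[OF g] prod p0 hg0 a eq eq' g1 that
        in auto)
  have f_cnj: "f (cnj z) = cnj (f z)" if z: "z \<in> unit_disc" for z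
  proof -
    have "?P z = p z" using prod[OF z] G[OF z] hg0[OF z] by simp
    then have "p (cnj z) = cnj (p z)" "g (cnj z) = cnj (g z)"
      using G[OF z] by (metis complex_cnj_cnj)+
    then show ?thesis using f z by (simp add: p_def)
  qed
  have cnj_disc: "cnj ` unit_disc = unit_disc"
    by (force simp: image_iff intro: bexI[of _ "cnj _"])
  have "cnj ` (f ` unit_disc) = f ` (cnj ` unit_disc)"
    using f_cnj by (force simp: image_image)
  then show ?thesis by (simp only: cnj_disc)
qed

end
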